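(* Let $E$ be an arbitrary directed graph and let $a\in F_E^\Gamma-\{0\}$. The following conditions are equivalent. (1) The element $a$ is periodic. (2) There is an element $b\in F_E^\Gamma$ whose support consists of (proper) vertices on cycles without exits and such that $a\to b$ by a sequence of applications of (A1) only. (3) Any path originating at a generator in the support of $a$ is a prefix of a path $p$ ending in one of finitely many cycles with no exits and such that all vertices of $p$ are regular. Every infinite path originating at a vertex in the support of $a$ ends in a cycle with no exits.
   Context: Setup. $\Gamma=\{x^n\mid n\in\mathbb Z\}$ is the infinite cyclic group generated by $x$. $E$ is an arbitrary directed graph with vertex set $E^0$, edge set $E^1$, source map $\mathbf s$ and range map $\mathbf r$. A vertex $v$ is a sink if $\mathbf s^{-1}(v)=\emptyset$, regular if $\mathbf s^{-1}(v)$ is finite and nonempty, and an infinite emitter if $\mathbf s^{-1}(v)$ is infinite. For every infinite emitter $v$ and every finite nonempty $Z\subseteq \mathbf s^{-1}(v)$ introduce a symbol $q_Z=q_Z^v$, called an improper vertex; elements of $E^0$ are called proper vertices. $F_E^\Gamma$ is the free commutative $\Gamma$-monoid on all proper and improper vertices (these are called the generators): its elements are finite formal sums of monomials $x^m g$ ($m\in\mathbb Z$, $g$ a generator), and $x^n$ acts by $x^n(x^m g)=x^{n+m}g$. The support of an element is the set of generators occurring in it. The relation $\to_1$ on $F_E^\Gamma-\{0\}$ is given, for all $a\in F_E^\Gamma$ and $m\in\mathbb Z$, by: (A1) $a+x^m v\to_1 a+\sum_{e\in \mathbf s^{-1}(v)}x^{m+1}\mathbf r(e)$ for $v$ regular;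 (A2) $a+x^m v\to_1 a+x^m q_Z+\sum_{e\in Z}x^{m+1}\mathbf r(e)$ for $v$ an infinite emitter and $Z\subseteq \mathbf s^{-1}(v)$ finite and nonempty; (A3) $a+x^m q_Z\to_1 a+x^m q_W+\sum_{e\in W-Z}x^{m+1}\mathbf r(e)$ for $v$ an infinite emitter and finite nonempty $Z\subsetneq W\subseteq \mathbf s^{-1}(v)$. The relation $\to$ is the reflexive and transitive closure of $\to_1$ on $F_E^\Gamma$, and $\sim$ is the congruence on $F_E^\Gamma$ generated by $\to$. "$a\to b$ by applications of (A1) only" means there are $a=a_0\to_1 a_1\to_1\cdots\to_1 a_n=b$, $n\ge 0$, with each step an instance of (A1). An element $a\in F_E^\Gamma$ is periodic if $a\sim x^n a$ for some positive integer $n$. Paths. Vertices are paths of length $0$ (trivial paths). A path $q$ is a prefix of a path $p$ if $p=qr$ for some (possibly trivial) path $r$. A cycle is a closed path $e_1\cdots e_n$, $n\geq 1$, with $\mathbf s(e_i)\neq \mathbf s(e_j)$ for $i\ne j$. A cycle has an exit if some vertex on it emits an edge which is not on the cycle. A path ends in a cycle if its range is a vertex of that cycle. An infinite path is a sequence $e_1e_2\ldots$ of edges with $\mathbf r(e_i)=\mathbf s(e_{i+1})$; it ends in a cycle $c$ if $e_ne_{n+1}\ldots=cc\ldots$ for some $n$ (with $c$ based at a suitable vertex). A path originating at a proper vertex $v$ is a path with source $v$; a path originating at an improper vertex $q^v_Z$ is a path with source $v$ which is trivial or has its first edge not in $Z$. *)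

theory Defs
  imports "Graph_Theory.Arc_Walk" "HOL-Library.Multiset"
begin

(* A directed graph is a wf_digraph of Graph_Theory: multiple arcs, loops and infinitely
   many vertices and arcs are allowed; the source map is tail and the range map is head. *)

definition regular_vertex :: "('v,'e) pre_digraph \<Rightarrow> 'v \<Rightarrow> bool" where
  "regular_vertex E v \<longleftrightarrow> v \<in> verts E \<and> finite (out_arcs E v) \<and> out_arcs E v \<noteq> {}"

definition infinite_emitter :: "('v,'e) pre_digraph \<Rightarrow> 'v \<Rightarrow> bool" where
  "infinite_emitter E v \<longleftrightarrow> v \<in> verts E \<and> infinite (out_arcs E v)"

(* Improper v Z is the symbol q_Z^v; it is a generator of E only under the side conditions
   in generators. *)
datatype ('v,'e) generator = Proper 'v | Improper 'v "'e set"

definition generators :: "('v,'e) pre_digraph \<Rightarrow> ('v,'e) generator set" where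
  "generators E = Proper ` verts E \<union>
     {Improper v Z |v Z. infinite_emitter E v \<and> finite Z \<and> Z \<noteq> {} \<and> Z \<subseteq> out_arcs E v}"

(* A finite formal sum of monomials x^m g is the multiset of the pairs (m, g). *)
type_synonym ('v,'e) formal_sum = "(int \<times> ('v,'e) generator) multiset"

definition monom_gen :: "int \<Rightarrow> ('v,'e) generator \<Rightarrow> ('v,'e) formal_sum" where
  "monom_gen m g = {#(m, g)#}"

(* The action of x^n. *)
definition shift :: "int \<Rightarrow> ('v,'e) formal_sum \<Rightarrow> ('v,'e) formal_sum" where
  "shift n a = image_mset (\<lambda>(m, g). (n + m, g)) a"

definition supp :: "('v,'e) formal_sum \<Rightarrow> ('v,'e) generator set" where
  "supp a = snd ` set_mset a"

(* The carrier of the free commutative monoid F_E. *)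
definition free_monoid :: "('v,'e) pre_digraph \<Rightarrow> ('v,'e) formal_sum set" where
  "free_monoid E = {a. supp a \<subseteq> generators E}"

inductive A1 :: "('v,'e) pre_digraph \<Rightarrow> ('v,'e) formal_sum \<Rightarrow> ('v,'e) formal_sum \<Rightarrow> bool"
  for E where
  "\<lbrakk>a \<in> free_monoid E; regular_vertex E v\<rbrakk> \<Longrightarrow>
   A1 E (a + monom_gen m (Proper v))
        (a + (\<Sum>e\<in>out_arcs E v. monom_gen (m + 1) (Proper (head E e))))"

inductive A2 :: "('v,'e) pre_digraph \<Rightarrow> ('v,'e) formal_sum \<Rightarrow> ('v,'e) formal_sum \<Rightarrow> bool"
  for E where
  "\<lbrakk>a \<in> free_monoid E; infinite_emitter E v; finite Z; Z \<noteq> {}; Z \<subseteq> out_arcs E v\<rbrakk> \<Longrightarrow>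
   A2 E (a + monom_gen m (Proper v))
        (a + monom_gen m (Improper v Z) + (\<Sum>e\<in>Z. monom_gen (m + 1) (Proper (head E e))))"

inductive A3 :: "('v,'e) pre_digraph \<Rightarrow> ('v,'e) formal_sum \<Rightarrow> ('v,'e) formal_sum \<Rightarrow> bool"
  for E where
  "\<lbrakk>a \<in> free_monoid E; infinite_emitter E v; Z \<noteq> {}; Z \<subset> W; finite W; W \<subseteq> out_arcs E v\<rbrakk> \<Longrightarrow>
   A3 E (a + monom_gen m (Improper v Z))
        (a + monom_gen m (Improper v W) + (\<Sum>e\<in>W - Z. monom_gen (m + 1) (Proper (head E e))))"

definition step1 :: "('v,'e) pre_digraph \<Rightarrow> ('v,'e) formal_sum \<Rightarrow> ('v,'e) formal_sum \<Rightarrow> bool" where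
  "step1 E a b \<longleftrightarrow> A1 E a b \<or> A2 E a b \<or> A3 E a b"

definition arrow :: "('v,'e) pre_digraph \<Rightarrow> ('v,'e) formal_sum \<Rightarrow> ('v,'e) formal_sum \<Rightarrow> bool" where
  "arrow E a b \<longleftrightarrow> a \<in> free_monoid E \<and> (step1 E)\<^sup>*\<^sup>* a b"

definition arrow_A1 :: "('v,'e) pre_digraph \<Rightarrow> ('v,'e) formal_sum \<Rightarrow> ('v,'e) formal_sum \<Rightarrow> bool" where
  "arrow_A1 E a b \<longleftrightarrow> a \<in> free_monoid E \<and> (A1 E)\<^sup>*\<^sup>* a b"

(* Congruence of monoids with an action of the infinite cyclic group, hence the closure
   under shift as well as under addition. *)
inductive cong_gen :: "('v,'e) pre_digraph \<Rightarrow> ('v,'e) formal_sum \<Rightarrow> ('v,'e) formal_sum \<Rightarrow> bool"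
  for E where
  base: "arrow E a b \<Longrightarrow> cong_gen E a b"
| refl: "a \<in> free_monoid E \<Longrightarrow> cong_gen E a a"
| sym: "cong_gen E a b \<Longrightarrow> cong_gen E b a"
| trans: "\<lbrakk>cong_gen E a b; cong_gen E b c\<rbrakk> \<Longrightarrow> cong_gen E a c"
| add: "\<lbrakk>cong_gen E a b; cong_gen E c d\<rbrakk> \<Longrightarrow> cong_gen E (a + c) (b + d)"
| act: "cong_gen E a b \<Longrightarrow> cong_gen E (shift n a) (shift n b)"

definition periodic :: "('v,'e) pre_digraph \<Rightarrow> ('v,'e) formal_sum \<Rightarrow> bool" where
  "periodic E a \<longleftrightarrow> (\<exists>n>0. cong_gen E a (shift n a))"

(* A path is a pair of its source and its list of edges, so that the trivial path at a
   vertex v is (v, []). *)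
type_synonym ('v,'e) dpath = "'v \<times> 'e list"

definition path_range :: "('v,'e) pre_digraph \<Rightarrow> ('v,'e) dpath \<Rightarrow> 'v" where
  "path_range E p = pre_digraph.awlast E (fst p) (snd p)"

definition path_verts :: "('v,'e) pre_digraph \<Rightarrow> ('v,'e) dpath \<Rightarrow> 'v set" where
  "path_verts E p = set (pre_digraph.awalk_verts E (fst p) (snd p))"

definition is_path :: "('v,'e) pre_digraph \<Rightarrow> ('v,'e) dpath \<Rightarrow> bool" where
  "is_path E p \<longleftrightarrow> pre_digraph.awalk E (fst p) (snd p) (path_range E p)"

definition path_prefix :: "('v,'e) pre_digraph \<Rightarrow> ('v,'e) dpath \<Rightarrow> ('v,'e) dpath \<Rightarrow> bool" where
  "path_prefix E q p \<longleftrightarrow> is_path E q \<and> is_path E p \<and>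
     (\<exists>r. is_path E r \<and> fst r = path_range E q \<and> p = (fst q, snd q @ snd r))"

(* pre_digraph.cycle requires the ranges, rather than the sources, of the edges to be
   distinct; for a closed path these are the same vertices. *)
definition cycle_verts :: "('v,'e) pre_digraph \<Rightarrow> 'e list \<Rightarrow> 'v set" where
  "cycle_verts E c = tail E ` set c"

definition has_exit :: "('v,'e) pre_digraph \<Rightarrow> 'e list \<Rightarrow> bool" where
  "has_exit E c \<longleftrightarrow> (\<exists>v\<in>cycle_verts E c. \<exists>e\<in>out_arcs E v. e \<notin> set c)"

definition cycle_no_exit :: "('v,'e) pre_digraph \<Rightarrow> 'e list \<Rightarrow> bool" where
  "cycle_no_exit E c \<longleftrightarrow> pre_digraph.cycle E c \<and> \<not> has_exit E c"

definition path_ends_in :: "('v,'e) pre_digraph \<Rightarrow> ('v,'e) dpath \<Rightarrow> 'e list \<Rightarrow> bool" where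
  "path_ends_in E p c \<longleftrightarrow> path_range E p \<in> cycle_verts E c"

definition is_inf_path :: "('v,'e) pre_digraph \<Rightarrow> (nat \<Rightarrow> 'e) \<Rightarrow> bool" where
  "is_inf_path E f \<longleftrightarrow> (\<forall>i. f i \<in> arcs E \<and> head E (f i) = tail E (f (Suc i)))"

(* The rotation by k accounts for the choice of the vertex at which c is based. *)
definition inf_path_ends_in :: "(nat \<Rightarrow> 'e) \<Rightarrow> 'e list \<Rightarrow> bool" where
  "inf_path_ends_in f c \<longleftrightarrow> (\<exists>n k. \<forall>i. f (n + i) = rotate k c ! (i mod length c))"

fun path_from :: "('v,'e) pre_digraph \<Rightarrow> ('v,'e) generator \<Rightarrow> ('v,'e) dpath \<Rightarrow> bool" where
  "path_from E (Proper v) p \<longleftrightarrow> is_path E p \<and> fst p = v"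
| "path_from E (Improper v Z) p \<longleftrightarrow>
     is_path E p \<and> fst p = v \<and> (snd p = [] \<or> hd (snd p) \<notin> Z)"

fun inf_path_from :: "('v,'e) pre_digraph \<Rightarrow> ('v,'e) generator \<Rightarrow> (nat \<Rightarrow> 'e) \<Rightarrow> bool" where
  "inf_path_from E (Proper v) f \<longleftrightarrow> is_inf_path E f \<and> tail E (f 0) = v"
| "inf_path_from E (Improper v Z) f \<longleftrightarrow> is_inf_path E f \<and> tail E (f 0) = v \<and> f 0 \<notin> Z"

end

theory Submission
  imports Defs
begin

text \<open>
  Call a vertex tame if it lies on a cycle without exits, or if it is regular and all its
  successors are tame. Well-founded unfolding of this notion shows that (2) and (3) both say that
  the support of \<open>a\<close> consists of tame proper vertices, and (2) implies (1) because a vertex on a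
  cycle without exits is congruent to a shift of itself.

  For the converse, two invariants of the congruence replace confluence of \<open>\<rightarrow>\<close>. For a vertex
  \<open>w\<close> that is not regular, the set of degrees at which \<open>w\<close> is reached from \<open>a\<close> is invariant
  and bounded below; if \<open>a\<close> is periodic it is also invariant under a nonzero translation, hence
  empty. So only (A1) ever applies, and expanding all monomials of \<open>a\<close> up to degree \<open>M\<close> yields a
  multiset of vertices that, for large \<open>M\<close>, depends only on the class of \<open>a\<close> and is therefore
  periodic in \<open>M\<close>. Expansion does not decrease its size, so eventually each of its vertices
  emits a single edge, and these edges permute a finite set of vertices.
\<close>

section \<open>Cycles without exits\<close>

definition no_exit_verts :: "('v,'e) pre_digraph \<Rightarrow> 'v set" where
  "no_exit_verts E = {v. \<exists>c. cycle_no_exit E c \<and> v \<in> cycle_verts E c}"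

context wf_digraph
begin

text \<open>The heads of the edges of a cycle are distinct and, cyclically, each head is the tail of
  the next edge, so the tails are distinct too. Hence only one edge of \<open>c\<close> leaves each
  of its vertices, and without exits no other edge does.\<close>

lemma cycle_no_exit_nth:
  assumes "cycle_no_exit G c" "i < length c"
  shows "out_arcs G (tail G (c ! i)) = {c ! i}"
    and "head G (c ! i) = tail G (c ! (Suc i mod length c))"
proof -
  let ?n = "length c"
  obtain u where u: "awalk u c u" "distinct (tl (awalk_verts u c))" "c \<noteq> []"
    using assms by (auto simp: cycle_no_exit_def cycle_def)
  then have cas: "cas u c u" and arcs: "set c \<subseteq> arcs G" by (auto simp: awalk_def)
  \<comment> \<open>Both sides are the vertex sequence of the walk, read off from the tails and from
    the heads; comparing entry \<open>Suc j\<close> gives \<open>next_tail\<close>.\<close>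
  have eq: "map (tail G) c @ [head G (last c)] = tail G (hd c) # map (head G) c"
    using awalk_verts_conv[of u c] awalk_verts_conv'[OF cas] u(3) by simp
  have hd_last: "head G (last c) = tail G (hd c)"
    using awlast_if_cas[OF cas] cas u(3) by (simp add: awalk_verts_conv cas_simp)
  have dist: "distinct (map (head G) c)"
    using u(2,3) awalk_verts_conv'[OF cas] by simp
  have next_tail: "head G (c ! j) = tail G (c ! (Suc j mod ?n))" if "j < ?n" for j
  proof (cases "Suc j = ?n")
    case True
    then have "c ! j = last c" using u(3) by (metis diff_Suc_1 last_conv_nth)
    then show ?thesis using True hd_last u(3) by (simp add: hd_conv_nth)
  next
    case False
    with that have less: "Suc j < ?n" by simp
    have "(map (tail G) c @ [head G (last c)]) ! Suc j = (tail G (hd c) # map (head G) c) ! Suc j"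
      using eq by simp
    then show ?thesis using less by (simp add: nth_append)
  qed
  have "\<exists>j<?n. Suc j mod ?n = i" if "i < ?n" for i
  proof (cases i)
    case 0
    then show ?thesis using that by (intro exI[of _ "?n - 1"]) auto
  next
    case (Suc j)
    then show ?thesis using that by (intro exI[of _ j]) auto
  qed
  then have inj: "j = k" if "j < ?n" "k < ?n" "tail G (c ! j) = tail G (c ! k)" for j k
    using that next_tail dist by (metis length_map nth_eq_iff_index_eq nth_map)
  have "\<not> has_exit G c" using assms by (simp add: cycle_no_exit_def)
  then have "e \<in> set c" if "e \<in> out_arcs G (tail G (c ! i))" for e
    using that nth_mem[OF assms(2)] unfolding has_exit_def cycle_verts_def by blast
  then have "e = c ! i" if "e \<in> out_arcs G (tail G (c ! i))" for e
    using that inj[OF _ assms(2)] by (metis in_out_arcs_conv in_set_conv_nth)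
  then show "out_arcs G (tail G (c ! i)) = {c ! i}"
    using arcs nth_mem[OF assms(2)] by auto
  show "head G (c ! i) = tail G (c ! (Suc i mod ?n))"
    by (rule next_tail[OF assms(2)])
qed

lemma out_arcs_cycle_vert:
  assumes "cycle_no_exit G c" "v \<in> cycle_verts G c"
  obtains e where "out_arcs G v = {e}" "head G e \<in> cycle_verts G c"
proof -
  obtain i where i: "i < length c" "v = tail G (c ! i)"
    using assms(2) by (auto simp: cycle_verts_def in_set_conv_nth)
  have "Suc i mod length c < length c" using i(1) by (intro mod_less_divisor) auto
  then have "head G (c ! i) \<in> cycle_verts G c"
    using cycle_no_exit_nth(2)[OF assms(1) i(1)] by (simp add: cycle_verts_def)
  with that cycle_no_exit_nth(1)[OF assms(1) i(1)] i(2) show thesis by auto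
qed

lemma regular_cycle_vert:
  assumes "cycle_no_exit G c" "v \<in> cycle_verts G c"
  shows "regular_vertex G v"
proof -
  obtain e where e: "out_arcs G v = {e}" using assms by (rule out_arcs_cycle_vert)
  then have "v \<in> verts G" by (metis in_out_arcs_conv singletonI tail_in_verts)
  then show ?thesis by (simp add: regular_vertex_def e)
qed

text \<open>The cycle consists of the edges followed up to the first return to \<open>u 0\<close>;
  minimality of the return time \<open>l\<close> makes it simple.\<close>

lemma cycle_no_exitI:
  assumes arcs: "\<And>i. out_arcs G (u i) = {f i}"
    and step: "\<And>i. u (Suc i) = head G (f i)"
    and det: "\<And>i k. u i = u k \<Longrightarrow> u (Suc i) = u (Suc k)"
    and "j > 0" "u j = u 0"
  shows "u 0 \<in> no_exit_verts G"
proof -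
  define l where "l = (LEAST l. 0 < l \<and> u l = u 0)"
  have l: "0 < l" "u l = u 0"
    unfolding l_def using LeastI[of "\<lambda>l. 0 < l \<and> u l = u 0" j] assms(4,5) by auto
  have least: "l \<le> k" if "0 < k" "u k = u 0" for k
    unfolding l_def using that by (intro Least_le) auto
  have det': "u (i + m) = u (k + m)" if "u i = u k" for i k m
    using that by (induction m) (auto intro: det)
  \<comment> \<open>A repetition, continued for \<open>l - k\<close> further steps, would be a
    return before time \<open>l\<close>. The indices run from 1 to \<open>l\<close> because
    \<open>cycle\<close> asks for distinct heads and the head of \<open>f i\<close> is
    \<open>u (Suc i)\<close>.\<close>
  have neq: "u i \<noteq> u k" if "0 < i" "i < k" "k \<le> l" for i k
  proof
    assume "u i = u k"
    from det'[OF this, of "l - k"] that have "u (i + (l - k)) = u l" by simp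
    with least[of "i + (l - k)"] l that show False by simp
  qed
  have tail: "tail G (f i) = u i" "f i \<in> arcs G" for i
    using arcs[of i] by auto
  define c where "c = map f [0..<l]"
  have "cas (u 0) (map f [0..<k]) (u k)" for k
    by (induction k) (auto simp: tail step awlast_if_cas)
  then have cas: "cas (u 0) c (u 0)" unfolding c_def using l(2) by metis
  have "u 0 \<in> verts G" using tail[of 0] tail_in_verts by metis
  then have walk: "awalk (u 0) c (u 0)"
    using cas tail(2) by (auto simp: awalk_def c_def)
  have "c \<noteq> []" using l(1) by (simp add: c_def)
  moreover have "distinct (map (head G) c)"
    unfolding distinct_conv_nth c_def
    by (auto simp: step[symmetric]) (metis Suc_leI linorder_neqE_nat neq not_less_eq zero_less_Suc)
  ultimately have cyc: "cycle c"
    unfolding cycle_def using walk awalk_verts_conv'[OF cas] by auto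
  have "\<not> has_exit G c"
    by (auto simp: has_exit_def cycle_verts_def c_def tail arcs)
  moreover have "u 0 \<in> cycle_verts G c"
    using l(1) tail[of 0] by (force simp: cycle_verts_def c_def)
  ultimately show ?thesis using cyc by (auto simp: no_exit_verts_def cycle_no_exit_def)
qed

lemma inf_path_ends_in_cycle:
  assumes c: "cycle_no_exit G c" and f: "is_inf_path G f" and v: "tail G (f 0) \<in> cycle_verts G c"
  shows "inf_path_ends_in f c"
proof -
  obtain k where k: "k < length c" "tail G (f 0) = tail G (c ! k)"
    using v by (auto simp: cycle_verts_def in_set_conv_nth)
  then have pos: "0 < length c" by linarith
  have next_arc: "f i = c ! j" if "tail G (f i) = tail G (c ! j)" "j < length c" for i j
  proof -
    have "f i \<in> out_arcs G (tail G (c ! j))" using f that by (auto simp: is_inf_path_def)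
    then show ?thesis using cycle_no_exit_nth(1)[OF c that(2)] by auto
  qed
  have "f i = c ! ((k + i) mod length c)" for i
  proof (induction i)
    case 0
    then show ?case using k next_arc by simp
  next
    case (Suc i)
    have "tail G (f (Suc i)) = head G (f i)" using f by (simp add: is_inf_path_def)
    also have "\<dots> = tail G (c ! ((k + Suc i) mod length c))"
      using cycle_no_exit_nth(2)[OF c, of "(k + i) mod length c"] pos Suc
      by (simp add: mod_Suc_eq)
    finally show ?case using next_arc pos by simp
  qed
  \<comment> \<open>The path runs along the cycle from its first edge on; rotating by the position
    \<open>k\<close> of its first vertex aligns it with \<open>c\<close>.\<close>
  then have "\<forall>i. f (0 + i) = rotate k c ! (i mod length c)"
    using pos by (simp add: nth_rotate mod_add_right_eq add.commute)
  then show ?thesis unfolding inf_path_ends_in_def by blast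
qed

section \<open>Paths\<close>

lemma is_path_Nil [simp]: "is_path G (v, []) \<longleftrightarrow> v \<in> verts G"
  by (simp add: is_path_def path_range_def awalk_Nil_iff)

lemma is_path_Cons [simp]:
  "is_path G (v, e # p) \<longleftrightarrow> e \<in> out_arcs G v \<and> is_path G (head G e, p)"
  by (auto simp: is_path_def path_range_def awalk_Cons_iff)

lemma path_range_Nil [simp]: "path_range G (v, []) = v"
  by (simp add: path_range_def)

lemma path_range_Cons [simp]: "path_range G (v, e # p) = path_range G (head G e, p)"
  by (simp add: path_range_def)

lemma path_verts_Nil [simp]: "path_verts G (v, []) = {v}"
  by (simp add: path_verts_def)

lemma path_verts_Cons [simp]:
  "path_verts G (v, e # p) = insert (tail G e) (path_verts G (head G e, p))"
  by (simp add: path_verts_def)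

lemma is_path_append:
  "is_path G (v, p @ q) \<longleftrightarrow> is_path G (v, p) \<and> is_path G (path_range G (v, p), q)"
proof (induction p arbitrary: v)
  case Nil
  show ?case by (auto simp: is_path_def awalk_Nil_iff)
qed auto

lemma path_range_append: "path_range G (v, p @ q) = path_range G (path_range G (v, p), q)"
  by (induction p arbitrary: v) auto

lemma path_range_in_path_verts: "path_range G p \<in> path_verts G p"
  by (simp add: path_range_def path_verts_def)

lemma path_range_in_path_verts_append:
  "is_path G (v, p @ q) \<Longrightarrow> path_range G (v, p) \<in> path_verts G (v, p @ q)"
proof (induction p arbitrary: v)
  case Nil
  then show ?case by (cases q) auto
qed auto

lemma path_prefix_iff:
  "path_prefix G (v, q) p \<longleftrightarrow> (\<exists>r. p = (v, q @ r)) \<and> is_path G p"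
  by (auto simp: path_prefix_def is_path_append intro: exI[of _ "(path_range G (v, q), _)"])

lemma cycle_path:
  assumes "cycle_no_exit G c" "v \<in> cycle_verts G c" "is_path G (v, q)"
  shows "path_verts G (v, q) \<subseteq> cycle_verts G c"
  using assms(2,3)
proof (induction q arbitrary: v)
  case (Cons e q)
  obtain e' where "out_arcs G v = {e'}" "head G e' \<in> cycle_verts G c"
    using assms(1) Cons.prems(1) by (rule out_arcs_cycle_vert)
  moreover from this Cons.prems have "tail G e = v" "e = e'" by auto
  ultimately show ?case using Cons by simp
qed simp

end

section \<open>Formal sums and their expansions\<close>

text \<open>Multiset induction phrased with \<open>monom_gen\<close>, so that the rules about
  monomials apply in the induction step.\<close>

lemma formal_sum_induct [case_names empty add]:
  assumes "P {#}" "\<And>m g a. P a \<Longrightarrow> P (monom_gen m g + a)"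
  shows "P a"
proof (induction a)
  case (add x a)
  then show ?case using assms(2)[of a "fst x" "snd x"] by (simp add: monom_gen_def)
qed (rule assms(1))

lemma supp_simps [simp]:
  "supp {#} = {}" "supp (a + b) = supp a \<union> supp b" "supp (monom_gen m g) = {g}"
  by (auto simp: supp_def monom_gen_def)

lemma supp_sum [simp]: "finite I \<Longrightarrow> supp (sum h I) = (\<Union>i\<in>I. supp (h i))"
  by (induction I rule: finite_induct) auto

lemma free_monoid_simps [simp]:
  "{#} \<in> free_monoid E"
  "a + b \<in> free_monoid E \<longleftrightarrow> a \<in> free_monoid E \<and> b \<in> free_monoid E"
  "monom_gen m g \<in> free_monoid E \<longleftrightarrow> g \<in> generators E"
  by (auto simp: free_monoid_def)

lemma Proper_in_generators [simp]: "Proper v \<in> generators E \<longleftrightarrow> v \<in> verts E"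
  by (auto simp: generators_def)

lemma shift_simps [simp]:
  "shift n {#} = {#}" "shift n (a + b) = shift n a + shift n b"
  "shift n (monom_gen m g) = monom_gen (n + m) g"
  "shift n (shift k a) = shift (n + k) a" "shift 0 a = a"
  by (simp_all add: shift_def monom_gen_def multiset.map_comp o_def case_prod_unfold add.assoc)

lemma regular_vertex_in_verts: "regular_vertex E v \<Longrightarrow> v \<in> verts E"
  by (simp add: regular_vertex_def)

section \<open>Derivations by (A1)\<close>

lemma arrow_A1_refl: "a \<in> free_monoid E \<Longrightarrow> arrow_A1 E a a"
  by (simp add: arrow_A1_def)

lemma A1_add:
  assumes "A1 E a b" "c \<in> free_monoid E"
  shows "A1 E (a + c) (b + c)"
  using assms(1)
proof cases
  case (1 a' v m)
  with A1.intros[of "a' + c" E v m] assms(2) show ?thesis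
    by (simp add: add.assoc add.commute add.left_commute)
qed

lemma A1_imp_cong_gen:
  assumes "A1 E a b"
  shows "cong_gen E a b"
proof -
  have "a \<in> free_monoid E" using assms by cases (auto dest: regular_vertex_in_verts)
  with assms show ?thesis by (intro cong_gen.base) (auto simp: arrow_def step1_def)
qed

lemma arrow_A1_imp_cong_gen:
  assumes "arrow_A1 E a b"
  shows "cong_gen E a b"
proof -
  have "(A1 E)\<^sup>*\<^sup>* a b" "a \<in> free_monoid E" using assms by (auto simp: arrow_A1_def)
  then show ?thesis
    by induction (simp_all add: cong_gen.refl, metis cong_gen.trans A1_imp_cong_gen)
qed

context wf_digraph
begin

lemma successors_free_monoid:
  "regular_vertex G v \<Longrightarrow> (\<Sum>e\<in>out_arcs G v. monom_gen m (Proper (head G e))) \<in> free_monoid G"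
  by (auto simp: free_monoid_def regular_vertex_def)

lemma A1_free_monoid: "A1 G a b \<Longrightarrow> a \<in> free_monoid G \<and> b \<in> free_monoid G"
  by (auto elim!: A1.cases simp: successors_free_monoid regular_vertex_in_verts)

lemma arrow_A1_free_monoid:
  assumes "arrow_A1 G a b"
  shows "b \<in> free_monoid G"
proof -
  have "(A1 G)\<^sup>*\<^sup>* a b" "a \<in> free_monoid G" using assms by (auto simp: arrow_A1_def)
  then show ?thesis by induction (auto dest: A1_free_monoid)
qed

lemma arrow_A1_trans: "arrow_A1 G a b \<Longrightarrow> arrow_A1 G b c \<Longrightarrow> arrow_A1 G a c"
  by (auto simp: arrow_A1_def)

lemma arrow_A1_add_right:
  assumes "arrow_A1 G a b" "c \<in> free_monoid G"
  shows "arrow_A1 G (a + c) (b + c)"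
proof -
  have "(A1 G)\<^sup>*\<^sup>* a b" "a \<in> free_monoid G" using assms by (auto simp: arrow_A1_def)
  then have "(A1 G)\<^sup>*\<^sup>* (a + c) (b + c)"
    by induction (auto intro: A1_add[OF _ assms(2)] rtranclp.rtrancl_into_rtrancl)
  then show ?thesis using assms by (simp add: arrow_A1_def)
qed

lemma arrow_A1_add:
  assumes "arrow_A1 G a b" "arrow_A1 G c d"
  shows "arrow_A1 G (a + c) (b + d)"
proof -
  have "arrow_A1 G (a + c) (b + c)"
    using assms by (intro arrow_A1_add_right) (auto simp: arrow_A1_def)
  moreover have "arrow_A1 G (c + b) (d + b)"
    using assms by (intro arrow_A1_add_right) (auto intro: arrow_A1_free_monoid)
  ultimately show ?thesis by (metis add.commute arrow_A1_trans)
qed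

lemma A1_vertex:
  assumes "regular_vertex G v"
  shows "A1 G (monom_gen m (Proper v)) (\<Sum>e\<in>out_arcs G v. monom_gen (m + 1) (Proper (head G e)))"
  using A1.intros[of "{#}" G v m] assms by simp

section \<open>Tame vertices\<close>

text \<open>As a least fixed point this excludes infinite paths through regular vertices that never
  enter a cycle without exits.\<close>

inductive tame :: "'a \<Rightarrow> bool" where
  cycle: "v \<in> no_exit_verts G \<Longrightarrow> tame v"
| regular: "regular_vertex G v \<Longrightarrow> (\<And>e. e \<in> out_arcs G v \<Longrightarrow> tame (head G e)) \<Longrightarrow> tame v"

text \<open>Condition (2) as a predicate of the sum, so that it can be added up over monomials and
  pulled back along (A1).\<close>

definition settles :: "('a, 'b) formal_sum \<Rightarrow> bool" where
  "settles a \<longleftrightarrow> (\<exists>b\<in>free_monoid G. supp b \<subseteq> Proper ` no_exit_verts G \<and> arrow_A1 G a b)"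

lemma settles_empty: "settles {#}"
  unfolding settles_def by (rule bexI[of _ "{#}"]) (auto intro: arrow_A1_refl)

lemma settles_add:
  assumes "settles a" "settles b"
  shows "settles (a + b)"
proof -
  obtain c where "c \<in> free_monoid G" "supp c \<subseteq> Proper ` no_exit_verts G" "arrow_A1 G a c"
    using assms(1) unfolding settles_def by blast
  moreover obtain d where "d \<in> free_monoid G" "supp d \<subseteq> Proper ` no_exit_verts G" "arrow_A1 G b d"
    using assms(2) unfolding settles_def by blast
  ultimately show ?thesis
    unfolding settles_def by (intro bexI[of _ "c + d"]) (simp_all add: arrow_A1_add)
qed

lemma settles_sum: "finite I \<Longrightarrow> (\<And>i. i \<in> I \<Longrightarrow> settles (h i)) \<Longrightarrow> settles (sum h I)"
  by (induction I rule: finite_induct) (auto intro: settles_add settles_empty)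

lemma settles_A1: "A1 G a b \<Longrightarrow> settles b \<Longrightarrow> settles a"
  unfolding settles_def arrow_A1_def
  by (blast dest: A1_free_monoid intro: converse_rtranclp_into_rtranclp)

lemma no_exit_verts_regular: "v \<in> no_exit_verts G \<Longrightarrow> regular_vertex G v"
  by (auto simp: no_exit_verts_def intro: regular_cycle_vert)

lemma tame_settles: "tame v \<Longrightarrow> settles (monom_gen m (Proper v))"
proof (induction arbitrary: m rule: tame.induct)
  case (cycle v)
  then have "v \<in> verts G" by (intro regular_vertex_in_verts no_exit_verts_regular)
  with cycle show ?case
    unfolding settles_def by (intro bexI[of _ "monom_gen m (Proper v)"]) (auto intro: arrow_A1_refl)
next
  case (regular v)
  then have "finite (out_arcs G v)" by (simp add: regular_vertex_def)
  then have "settles (\<Sum>e\<in>out_arcs G v. monom_gen (m + 1) (Proper (head G e)))"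
    by (intro settles_sum regular.IH)
  with A1_vertex[OF regular.hyps(1)] show ?case by (rule settles_A1)
qed

text \<open>The heads of all edges leaving the expanded vertex occur in \<open>b\<close>, so the
  rule \<open>regular\<close> applies to it; the other monomials are unchanged.\<close>

lemma tame_A1:
  assumes "A1 G a b" "supp b \<subseteq> Proper ` Collect tame"
  shows "supp a \<subseteq> Proper ` Collect tame"
  using assms(1)
proof cases
  case (1 a' v m)
  then have "finite (out_arcs G v)" by (simp add: regular_vertex_def)
  then have "tame (head G e)" if "e \<in> out_arcs G v" for e
    using 1(2) assms(2) that by (auto simp del: in_out_arcs_conv)
  with 1(4) have "tame v" by (rule tame.regular)
  with 1 assms(2) show ?thesis by auto
qed

lemma settles_iff_tame: "settles a \<longleftrightarrow> supp a \<subseteq> Proper ` Collect tame"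
proof
  assume "settles a"
  then obtain b where "supp b \<subseteq> Proper ` no_exit_verts G" "(A1 G)\<^sup>*\<^sup>* a b"
    by (auto simp: settles_def arrow_A1_def)
  then have "supp b \<subseteq> Proper ` Collect tame" by (auto intro: tame.cycle)
  with \<open>(A1 G)\<^sup>*\<^sup>* a b\<close> show "supp a \<subseteq> Proper ` Collect tame"
    by (induction rule: converse_rtranclp_induct) (simp_all add: tame_A1)
next
  assume "supp a \<subseteq> Proper ` Collect tame"
  then show "settles a"
  proof (induction a rule: formal_sum_induct)
    case (add m g a)
    then show ?case by (intro settles_add add.IH) (auto intro: tame_settles)
  qed (rule settles_empty)
qed

section \<open>Tameness in terms of paths\<close>

text \<open>The path condition in (3). The set \<open>C\<close> is a parameter because one finite
  set of cycles has to serve all paths.\<close>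

definition extends_to_cycle :: "'b list set \<Rightarrow> ('a, 'b) dpath \<Rightarrow> bool" where
  "extends_to_cycle C q \<longleftrightarrow> (\<exists>p. path_prefix G q p \<and> (\<exists>c\<in>C. path_ends_in G p c) \<and>
     (\<forall>v\<in>path_verts G p. regular_vertex G v))"

lemma extends_to_cycle_iff:
  "extends_to_cycle C (v, q) \<longleftrightarrow>
     (\<exists>r. is_path G (v, q @ r) \<and> (\<exists>c\<in>C. path_range G (v, q @ r) \<in> cycle_verts G c) \<and>
       (\<forall>u\<in>path_verts G (v, q @ r). regular_vertex G u))"
  by (auto simp: extends_to_cycle_def path_prefix_iff path_ends_in_def)

lemma extends_to_cycle_mono: "extends_to_cycle C q \<Longrightarrow> C \<subseteq> D \<Longrightarrow> extends_to_cycle D q"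
  unfolding extends_to_cycle_def by blast

lemma extends_to_cycle_Cons:
  assumes "regular_vertex G v" "e \<in> out_arcs G v" "extends_to_cycle C (head G e, q)"
  shows "extends_to_cycle C (v, e # q)"
  using assms by (auto simp: extends_to_cycle_iff)

text \<open>Take the union of the sets of cycles. This is applied to the finitely many successors of
  a regular vertex and to the finitely many generators in a support.\<close>

lemma finite_common_cycles:
  assumes "finite I"
    and "\<And>i. i \<in> I \<Longrightarrow> \<exists>C. finite C \<and> (\<forall>c\<in>C. cycle_no_exit G c) \<and>
           (\<forall>q. P i q \<longrightarrow> extends_to_cycle C q)"
  shows "\<exists>C. finite C \<and> (\<forall>c\<in>C. cycle_no_exit G c) \<and>
           (\<forall>i\<in>I. \<forall>q. P i q \<longrightarrow> extends_to_cycle C q)"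
  using assms
proof (induction I rule: finite_induct)
  case empty
  show ?case by (intro exI[of _ "{}"]) simp
next
  case (insert i I)
  obtain C where C: "finite C" "\<forall>c\<in>C. cycle_no_exit G c"
      "\<And>k q. k \<in> I \<Longrightarrow> P k q \<Longrightarrow> extends_to_cycle C q"
    using insert.IH insert.prems by (metis insertCI)
  obtain D where D: "finite D" "\<forall>c\<in>D. cycle_no_exit G c" "\<And>q. P i q \<Longrightarrow> extends_to_cycle D q"
    using insert.prems by (metis insertCI)
  have "extends_to_cycle (C \<union> D) q" if "k \<in> insert i I" "P k q" for k q
  proof (cases "k = i")
    case True
    with that have "extends_to_cycle D q" by (intro D(3)) simp
    then show ?thesis by (rule extends_to_cycle_mono) simp
  next
    case False
    with that have "extends_to_cycle C q" by (intro C(3)[of k]) simp_all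
    then show ?thesis by (rule extends_to_cycle_mono) simp
  qed
  with C D show ?case by (intro exI[of _ "C \<union> D"]) auto
qed

lemma tame_paths:
  assumes "tame v"
  shows "\<exists>C. finite C \<and> (\<forall>c\<in>C. cycle_no_exit G c) \<and>
           (\<forall>q. is_path G (v, q) \<longrightarrow> extends_to_cycle C (v, q))"
  using assms
proof induction
  case (cycle v)
  then obtain c where c: "cycle_no_exit G c" "v \<in> cycle_verts G c"
    by (auto simp: no_exit_verts_def)
  have "extends_to_cycle {c} (v, q)" if q: "is_path G (v, q)" for q
  proof -
    \<comment> \<open>A path that starts on the cycle never leaves it, so it needs no
      extension.\<close>
    have "path_verts G (v, q) \<subseteq> cycle_verts G c" using c q by (rule cycle_path)
    then show ?thesis
      unfolding extends_to_cycle_iff using q path_range_in_path_verts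
      by (intro exI[of _ "[]"]) (auto intro: regular_cycle_vert[OF c(1)])
  qed
  with c(1) show ?case by (intro exI[of _ "{c}"]) simp
next
  case (regular v)
  have "finite (out_arcs G v)" using regular.hyps(1) by (simp add: regular_vertex_def)
  then have "\<exists>C. finite C \<and> (\<forall>c\<in>C. cycle_no_exit G c) \<and>
      (\<forall>e\<in>out_arcs G v. \<forall>q. is_path G q \<and> fst q = head G e \<longrightarrow> extends_to_cycle C q)"
    by (rule finite_common_cycles) (use regular.IH in auto)
  then obtain C where C: "finite C" "\<forall>c\<in>C. cycle_no_exit G c"
      "\<And>e q. e \<in> out_arcs G v \<Longrightarrow> is_path G (head G e, q) \<Longrightarrow> extends_to_cycle C (head G e, q)"
    by (metis fst_conv)
  have succ: "extends_to_cycle C (v, e # q)"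
    if "e \<in> out_arcs G v" "is_path G (head G e, q)" for e q
    using that by (intro extends_to_cycle_Cons regular.hyps C(3))
  have "extends_to_cycle C (v, q)" if "is_path G (v, q)" for q
  proof (cases q)
    case Nil
    \<comment> \<open>If \<open>v\<close> is not itself on a cycle, the trivial path has to be
      prolonged: any extension of the path \<open>[e]\<close> also extends it.\<close>
    obtain e where e: "e \<in> out_arcs G v"
      using regular.hyps(1) unfolding regular_vertex_def by blast
    then have "extends_to_cycle C (v, [e])" by (intro succ) auto
    then show ?thesis unfolding Nil extends_to_cycle_iff by (metis append_Cons append_Nil)
  next
    case (Cons e p)
    with that show ?thesis unfolding Cons by (intro succ) simp_all
  qed
  with C(1,2) show ?case by blast
qed

lemma tame_inf_paths:
  assumes "tame v" "is_inf_path G f" "tail G (f 0) = v"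
  shows "\<exists>c. cycle_no_exit G c \<and> inf_path_ends_in f c"
  using assms
proof (induction arbitrary: f)
  case (cycle v)
  then show ?case by (auto simp: no_exit_verts_def intro: inf_path_ends_in_cycle)
next
  case (regular v)
  have "f 0 \<in> out_arcs G v" using regular.prems by (auto simp: is_inf_path_def)
  moreover have "is_inf_path G (\<lambda>i. f (Suc i))" "tail G (f (Suc 0)) = head G (f 0)"
    using regular.prems by (auto simp: is_inf_path_def)
  ultimately obtain c where c: "cycle_no_exit G c" "inf_path_ends_in (\<lambda>i. f (Suc i)) c"
    using regular.IH by blast
  from c(2) have "inf_path_ends_in f c"
    unfolding inf_path_ends_in_def by (metis add_Suc)
  with c(1) show ?case by blast
qed

text \<open>A regular vertex that is not tame has a successor that is not tame. Iterating yields an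
  infinite path avoiding tame vertices, yet by assumption it runs into a cycle without
  exits.\<close>

lemma tameI_paths:
  assumes v: "v \<in> verts G"
    and reg: "\<And>q. is_path G (v, q) \<Longrightarrow> regular_vertex G (path_range G (v, q))"
    and inf: "\<And>f. is_inf_path G f \<Longrightarrow> tail G (f 0) = v \<Longrightarrow> \<exists>c. cycle_no_exit G c \<and> inf_path_ends_in f c"
  shows "tame v"
proof (rule ccontr)
  assume "\<not> tame v"
  \<comment> \<open>The choice is meaningful only at regular vertices that are not tame; the
    induction below shows that every \<open>u i\<close> is one.\<close>
  define nxt where "nxt u = (SOME e. e \<in> out_arcs G u \<and> \<not> tame (head G e))" for u
  define u where "u i = ((\<lambda>w. head G (nxt w)) ^^ i) v" for i
  have u_Suc: "u (Suc i) = head G (nxt (u i))" for i by (simp add: u_def)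
  let ?f = "\<lambda>i. nxt (u i)"
  have nxt: "nxt w \<in> out_arcs G w \<and> \<not> tame (head G (nxt w))"
    if "regular_vertex G w" "\<not> tame w" for w
    unfolding nxt_def by (rule someI_ex) (use that tame.regular in blast)
  have "is_path G (v, map ?f [0..<i]) \<and> path_range G (v, map ?f [0..<i]) = u i \<and> \<not> tame (u i)" for i
  proof (induction i)
    case 0
    show ?case using v \<open>\<not> tame v\<close> by (simp add: u_def)
  next
    case (Suc i)
    then have "regular_vertex G (u i)" using reg by metis
    with Suc nxt[of "u i"] show ?case by (simp add: is_path_append path_range_append u_Suc)
  qed
  note path = this
  have reg_u: "regular_vertex G (u i)" for i using path reg by metis
  have out: "?f i \<in> out_arcs G (u i)" for i using nxt reg_u path by blast
  have "is_inf_path G ?f" unfolding is_inf_path_def using out u_Suc by (metis in_out_arcs_conv)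
  moreover have "tail G (?f 0) = v" using out[of 0] by (simp add: u_def)
  ultimately obtain c n k where c: "cycle_no_exit G c"
    and n: "\<And>i. ?f (n + i) = rotate k c ! (i mod length c)"
    using inf[of ?f] by (auto simp: inf_path_ends_in_def)
  have "c \<noteq> []" using c by (auto simp: cycle_no_exit_def cycle_def)
  then have "?f n \<in> set c" using n[of 0] nth_mem[of 0 "rotate k c"] by simp
  then have "u n \<in> cycle_verts G c" using out[of n] by (force simp: cycle_verts_def)
  then have "tame (u n)" using c by (intro tame.cycle) (auto simp: no_exit_verts_def)
  then show False using path by blast
qed

lemma tame_iff_paths:
  assumes "a \<in> free_monoid G"
  shows "supp a \<subseteq> Proper ` Collect tame \<longleftrightarrow>
    (\<exists>C. finite C \<and> (\<forall>c\<in>C. cycle_no_exit G c) \<and>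
       (\<forall>g\<in>supp a. \<forall>q. path_from G g q \<longrightarrow> extends_to_cycle C q)) \<and>
    (\<forall>g\<in>supp a. \<forall>f. inf_path_from G g f \<longrightarrow> (\<exists>c. cycle_no_exit G c \<and> inf_path_ends_in f c))"
    (is "?tame \<longleftrightarrow> (\<exists>C. ?ext C) \<and> ?inf")
proof (intro iffI conjI)
  assume tame: ?tame
  have "\<exists>C. finite C \<and> (\<forall>c\<in>C. cycle_no_exit G c) \<and>
      (\<forall>q. path_from G g q \<longrightarrow> extends_to_cycle C q)" if g: "g \<in> supp a" for g
  proof -
    obtain v where v: "g = Proper v" "tame v" using tame g by blast
    show ?thesis using tame_paths[OF v(2)] unfolding v(1) by auto
  qed
  moreover have "finite (supp a)" by (simp add: supp_def)
  ultimately show "\<exists>C. ?ext C" by (intro finite_common_cycles)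
  show ?inf
  proof (intro ballI allI impI)
    fix g f assume "g \<in> supp a" "inf_path_from G g f"
    moreover from this obtain v where "g = Proper v" "tame v" using tame by blast
    ultimately show "\<exists>c. cycle_no_exit G c \<and> inf_path_ends_in f c"
      using tame_inf_paths by simp
  qed
next
  assume "(\<exists>C. ?ext C) \<and> ?inf"
  then obtain C where ext: "?ext C" and inf: ?inf by blast
  show ?tame
  proof
    fix g assume g: "g \<in> supp a"
    then have "g \<in> generators G" using assms by (auto simp: free_monoid_def)
    \<comment> \<open>The range of the path is a vertex of its extension, all of whose vertices are
      regular.\<close>
    have reg: "regular_vertex G (path_range G (u, q))" if "path_from G g (u, q)" for u q
    proof -
      have "extends_to_cycle C (u, q)" using ext g that by blast
      then show ?thesis
        unfolding extends_to_cycle_iff using path_range_in_path_verts_append by blast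
    qed
    show "g \<in> Proper ` Collect tame"
    proof (cases g)
      case (Proper v)
      have "tame v"
      proof (rule tameI_paths)
        show "v \<in> verts G" using \<open>g \<in> generators G\<close> Proper by simp
        show "regular_vertex G (path_range G (v, q))" if "is_path G (v, q)" for q
          using that Proper by (intro reg) simp
        show "\<exists>c. cycle_no_exit G c \<and> inf_path_ends_in f c"
          if "is_inf_path G f" "tail G (f 0) = v" for f
          using inf g that Proper by (metis inf_path_from.simps(1))
      qed
      then show ?thesis using Proper by simp
    next
      \<comment> \<open>The trivial path at \<open>v\<close> originates at this generator, which
        would make the infinite emitter \<open>v\<close> regular.\<close>
      case (Improper v Z)
      then have "infinite_emitter G v" using \<open>g \<in> generators G\<close> by (auto simp: generators_def)
      moreover from this have "regular_vertex G (path_range G (v, []))"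
        using Improper by (intro reg) (simp add: infinite_emitter_def)
      ultimately show ?thesis by (simp add: infinite_emitter_def regular_vertex_def)
    qed
  qed
qed

end

section \<open>Sums supported on cycles without exits are periodic\<close>

lemma cong_gen_shift_multiple:
  assumes "cong_gen E a (shift n a)" "a \<in> free_monoid E"
  shows "cong_gen E a (shift (int k * n) a)"
proof (induction k)
  case 0
  show ?case using assms(2) by (simp add: cong_gen.refl)
next
  case (Suc k)
  from cong_gen.trans[OF assms(1) cong_gen.act[OF Suc]] show ?case
    by (simp add: algebra_simps)
qed

text \<open>The product of the two periods is a common period.\<close>

lemma periodic_add:
  assumes "periodic E a" "periodic E b" "a \<in> free_monoid E" "b \<in> free_monoid E"
  shows "periodic E (a + b)"
proof -
  obtain n k where n: "n > 0" "cong_gen E a (shift n a)" and k: "k > 0" "cong_gen E b (shift k b)"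
    using assms by (auto simp: periodic_def)
  have "cong_gen E a (shift (n * k) a)" "cong_gen E b (shift (n * k) b)"
    using cong_gen_shift_multiple[OF n(2) assms(3), of "nat k"]
      cong_gen_shift_multiple[OF k(2) assms(4), of "nat n"] n(1) k(1)
    by (simp_all add: mult.commute)
  from cong_gen.add[OF this] n(1) k(1) show ?thesis
    unfolding periodic_def by (intro exI[of _ "n * k"]) simp
qed

lemma periodic_cong_gen:
  assumes "cong_gen E a b" "periodic E b"
  shows "periodic E a"
proof -
  obtain n where n: "n > 0" "cong_gen E b (shift n b)" using assms(2) by (auto simp: periodic_def)
  note cong_gen.trans[OF cong_gen.trans[OF assms(1) n(2)] cong_gen.act[OF cong_gen.sym[OF assms(1)]]]
  with n(1) show ?thesis by (auto simp: periodic_def)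
qed

context wf_digraph
begin

text \<open>Each vertex of the cycle emits one edge, so (A1) moves a monomial to the next vertex and
  raises its degree by one. Going round once gives the period \<open>length c\<close>.\<close>

lemma periodic_no_exit_vert:
  assumes "v \<in> no_exit_verts G"
  shows "periodic G (monom_gen m (Proper v))"
proof -
  obtain c i where c: "cycle_no_exit G c" and i: "i < length c" "v = tail G (c ! i)"
    using assms by (auto simp: no_exit_verts_def cycle_verts_def in_set_conv_nth)
  have pos: "0 < length c" using i by linarith
  let ?w = "\<lambda>j. tail G (c ! ((i + j) mod length c))"
  have "cong_gen G (monom_gen m (Proper v)) (monom_gen (m + int j) (Proper (?w j)))" for j
  proof (induction j)
    case 0
    have "v \<in> verts G" using assms by (intro regular_vertex_in_verts no_exit_verts_regular)
    then show ?case using i by (simp add: cong_gen.refl)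
  next
    case (Suc j)
    have less: "(i + j) mod length c < length c" using pos by simp
    note nth = cycle_no_exit_nth[OF c less]
    have "regular_vertex G (?w j)"
      using c less by (intro regular_cycle_vert) (auto simp: cycle_verts_def)
    from A1_vertex[OF this, of "m + int j"]
    have "A1 G (monom_gen (m + int j) (Proper (?w j))) (monom_gen (m + int (Suc j)) (Proper (?w (Suc j))))"
      using nth(1,2) by (simp add: mod_Suc_eq algebra_simps)
    with Suc show ?case by (rule cong_gen.trans[OF _ A1_imp_cong_gen])
  qed
  from this[of "length c"] i pos show ?thesis
    unfolding periodic_def by (intro exI[of _ "int (length c)"]) (simp add: add.commute)
qed

lemma periodic_no_exit_supp:
  "supp b \<subseteq> Proper ` no_exit_verts G \<Longrightarrow> periodic G b"
proof (induction b rule: formal_sum_induct)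
  case empty
  show ?case
    unfolding periodic_def by (intro exI[of _ 1]) (simp add: cong_gen.refl)
next
  case (add m g b)
  have free: "c \<in> free_monoid G" if "supp c \<subseteq> Proper ` no_exit_verts G" for c
  proof -
    have "Proper ` no_exit_verts G \<subseteq> generators G"
      using regular_vertex_in_verts[OF no_exit_verts_regular] by (auto simp: generators_def)
    with that show ?thesis unfolding free_monoid_def by blast
  qed
  obtain v where "v \<in> no_exit_verts G" "g = Proper v" using add.prems by auto
  then have "periodic G (monom_gen m g)" by (simp add: periodic_no_exit_vert)
  moreover have "periodic G b" using add by simp
  moreover have "monom_gen m g \<in> free_monoid G" "b \<in> free_monoid G"
    using add.prems free[of "monom_gen m g"] free[of b] by simp_all
  ultimately show ?case by (rule periodic_add)
qed

lemma settles_periodic: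
  assumes "settles a"
  shows "periodic G a"
proof -
  obtain b where "supp b \<subseteq> Proper ` no_exit_verts G" "arrow_A1 G a b"
    using assms unfolding settles_def by blast
  then show ?thesis
    using periodic_cong_gen[OF arrow_A1_imp_cong_gen periodic_no_exit_supp] by blast
qed

end

section \<open>Degrees at which a vertex is reached\<close>

primrec reach :: "('v,'e) pre_digraph \<Rightarrow> nat \<Rightarrow> 'v \<Rightarrow> 'v \<Rightarrow> bool" where
  "reach E 0 u w \<longleftrightarrow> u = w"
| "reach E (Suc k) u w \<longleftrightarrow> (\<exists>e\<in>out_arcs E u. reach E k (head E e) w)"

text \<open>Follows the convention of \<open>path_from\<close>: a nontrivial path from an improper
  vertex has its first edge outside \<open>Z\<close>.\<close>

fun reach_gen :: "('v,'e) pre_digraph \<Rightarrow> nat \<Rightarrow> ('v,'e) generator \<Rightarrow> 'v \<Rightarrow> bool" where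
  "reach_gen E k (Proper v) w \<longleftrightarrow> reach E k v w"
| "reach_gen E 0 (Improper v Z) w \<longleftrightarrow> v = w"
| "reach_gen E (Suc k) (Improper v Z) w \<longleftrightarrow> (\<exists>e\<in>out_arcs E v - Z. reach E k (head E e) w)"

text \<open>The degree grows by one along each edge, as in (A1) to (A3). A set remains meaningful
  when infinitely many paths lead to \<open>w\<close>.\<close>

definition degs :: "('v,'e) pre_digraph \<Rightarrow> 'v \<Rightarrow> ('v,'e) formal_sum \<Rightarrow> int set" where
  "degs E w a = {m + int k |m g k. (m, g) \<in># a \<and> reach_gen E k g w}"

lemma degs_empty [simp]: "degs E w {#} = {}"
  by (simp add: degs_def)

lemma degs_add [simp]: "degs E w (a + b) = degs E w a \<union> degs E w b"
  by (auto simp: degs_def)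

lemma degs_monom: "degs E w (monom_gen m g) = {m + int k |k. reach_gen E k g w}"
  by (auto simp: degs_def monom_gen_def)

lemma degs_sum [simp]: "finite I \<Longrightarrow> degs E w (sum h I) = (\<Union>i\<in>I. degs E w (h i))"
  by (induction I rule: finite_induct) auto

lemma degs_shift: "degs E w (shift n a) = (+) n ` degs E w a"
proof (induction a rule: formal_sum_induct)
  case (add m g a)
  have "{n + m + int k |k. reach_gen E k g w} = (+) n ` {m + int k |k. reach_gen E k g w}"
    by (auto simp: image_iff algebra_simps)
  with add show ?case by (simp add: degs_monom image_Un)
qed simp

lemma ex_nat_iff_0_Suc: "(\<exists>k. P k) \<longleftrightarrow> P 0 \<or> (\<exists>k. P (Suc k))"
  by (metis not0_implies_Suc)

text \<open>Splits the paths into the trivial one and those with a first edge.\<close>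

lemma degs_Proper:
  "degs E w (monom_gen m (Proper v)) =
     (if v = w then {m} else {}) \<union> (\<Union>e\<in>out_arcs E v. degs E w (monom_gen (m + 1) (Proper (head E e))))"
  by (rule set_eqI, unfold degs_monom mem_Collect_eq, subst ex_nat_iff_0_Suc)
    (auto simp del: in_out_arcs_conv simp: algebra_simps)

lemma degs_Improper:
  "degs E w (monom_gen m (Improper v Z)) =
     (if v = w then {m} else {}) \<union> (\<Union>e\<in>out_arcs E v - Z. degs E w (monom_gen (m + 1) (Proper (head E e))))"
  by (rule set_eqI, unfold degs_monom mem_Collect_eq, subst ex_nat_iff_0_Suc)
    (auto simp del: in_out_arcs_conv simp: algebra_simps)

text \<open>(A1) loses only the trivial path at a regular vertex, which is not \<open>w\<close>.
  (A2) and (A3) lose nothing: the new improper vertex keeps the trivial path and the edges outside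
  its index set, and the added sum supplies the remaining edges.\<close>

lemma degs_step1:
  assumes "step1 E a b" "\<not> regular_vertex E w"
  shows "degs E w a = degs E w b"
proof -
  consider "A1 E a b" | "A2 E a b" | "A3 E a b" using assms(1) by (auto simp: step1_def)
  then show ?thesis
  proof cases
    case 1
    then show ?thesis
    proof cases
      case (1 c v m)
      then have "v \<noteq> w" "finite (out_arcs E v)" using assms(2) by (auto simp: regular_vertex_def)
      with 1(1,2) show ?thesis by (simp add: degs_Proper[of E w m v])
    qed
  next
    case 2
    then show ?thesis
    proof cases
      case (1 c v Z m)
      then have "out_arcs E v = (out_arcs E v - Z) \<union> Z" by blast
      then show ?thesis
        unfolding 1(1,2) using 1(5) by (simp add: degs_Proper[of E w m v] degs_Improper) blast
    qed
  next
    case 3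
    then show ?thesis
    proof cases
      case (1 c v Z W m)
      then have "out_arcs E v - Z = (out_arcs E v - W) \<union> (W - Z)" by blast
      then show ?thesis
        unfolding 1(1,2) using 1(7) by (simp add: degs_Improper Un_assoc)
    qed
  qed
qed

lemma degs_cong_gen:
  assumes "cong_gen E a b" "\<not> regular_vertex E w"
  shows "degs E w a = degs E w b"
  using assms(1)
proof induction
  case (base a b)
  then have "(step1 E)\<^sup>*\<^sup>* a b" by (simp add: arrow_def)
  then show ?case by induction (simp_all add: degs_step1[OF _ assms(2)])
qed (simp_all add: degs_shift)

lemma degs_bounded_below: "\<exists>B. \<forall>d\<in>degs E w a. B \<le> d"
proof (induction a rule: formal_sum_induct)
  case (add m g a)
  then obtain B where "\<forall>d\<in>degs E w a. B \<le> d" by blast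
  then show ?case by (intro exI[of _ "min m B"]) (auto simp: degs_monom)
qed simp

section \<open>Periodic sums reach only regular vertices\<close>

definition regular_reach :: "('v,'e) pre_digraph \<Rightarrow> ('v,'e) formal_sum \<Rightarrow> bool" where
  "regular_reach E a \<longleftrightarrow> (\<forall>w. \<not> regular_vertex E w \<longrightarrow> degs E w a = {})"

lemma periodic_regular_reach:
  assumes "periodic E a"
  shows "regular_reach E a"
  unfolding regular_reach_def
proof (intro allI impI)
  fix w assume w: "\<not> regular_vertex E w"
  obtain n where n: "n > 0" "cong_gen E a (shift n a)" using assms by (auto simp: periodic_def)
  then have eq: "degs E w a = (+) n ` degs E w a"
    using degs_cong_gen[OF n(2) w] by (simp add: degs_shift)
  obtain B where B: "\<And>d. d \<in> degs E w a \<Longrightarrow> B \<le> d" using degs_bounded_below[of E w a] by blast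
  \<comment> \<open>Invariance under translation by \<open>n\<close> lets one descend from
    \<open>d\<close> in steps of \<open>n\<close>, against the lower bound \<open>B\<close>.\<close>
  have "d - int k * n \<in> degs E w a" if "d \<in> degs E w a" for d k
  proof (induction k)
    case (Suc k)
    then obtain d' where "d' \<in> degs E w a" "d - int k * n = n + d'" using eq by blast
    moreover from this have "d' = d - int (Suc k) * n" by (simp add: algebra_simps)
    ultimately show ?case by simp
  qed (use that in simp)
  then have "B \<le> d - int (nat (d - B + 1)) * n" if "d \<in> degs E w a" for d
    using B that by blast
  \<comment> \<open>Since \<open>n\<close> is at least 1, \<open>d - B + 1\<close> steps of descent
    suffice to pass below \<open>B\<close>.\<close>
  moreover have "d - int (nat (d - B + 1)) * n < B" if "d \<in> degs E w a" for d
  proof -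
    have "B \<le> d" using B that by blast
    moreover from this have "d - B + 1 \<le> (d - B + 1) * n"
      using n(1) by (simp add: mult_le_cancel_left1)
    moreover from \<open>B \<le> d\<close> have "int (nat (d - B + 1)) * n = (d - B + 1) * n" by simp
    ultimately show ?thesis by linarith
  qed
  ultimately show "degs E w a = {}" by (meson equals0I leD)
qed

section \<open>Level multisets\<close>

text \<open>A sum over an infinite set is empty by default, so infinite emitters contribute nothing,
  just like sinks.\<close>

definition expand :: "('v,'e) pre_digraph \<Rightarrow> 'v multiset \<Rightarrow> 'v multiset" where
  "expand E V = (\<Sum>v\<in>#V. \<Sum>e\<in>out_arcs E v. {#head E e#})"

lemma expand_simps [simp]:
  "expand E {#} = {#}" "expand E (V + W) = expand E V + expand E W"
  "expand E {#v#} = (\<Sum>e\<in>out_arcs E v. {#head E e#})"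
  by (simp_all add: expand_def)

lemma expand_add_mset: "expand E (add_mset v V) = (\<Sum>e\<in>out_arcs E v. {#head E e#}) + expand E V"
  by (simp add: expand_def)

lemma expand_pow_empty [simp]: "(expand E ^^ k) {#} = {#}"
  by (induction k) auto

lemma expand_pow_add: "(expand E ^^ k) (V + W) = (expand E ^^ k) V + (expand E ^^ k) W"
  by (induction k) auto

lemma expand_pow_sum: "(expand E ^^ k) (sum h I) = (\<Sum>i\<in>I. (expand E ^^ k) (h i))"
  by (induction I rule: infinite_finite_induct) (auto simp: expand_pow_add)

fun base_vertex :: "('v,'e) generator \<Rightarrow> 'v" where
  "base_vertex (Proper v) = v"
| "base_vertex (Improper v Z) = v"

text \<open>The vertices obtained by expanding every monomial up to degree \<open>M\<close>;
  meaningful only if \<open>M\<close> is at least the degree of every monomial.\<close>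

definition level :: "('v,'e) pre_digraph \<Rightarrow> int \<Rightarrow> ('v,'e) formal_sum \<Rightarrow> 'v multiset" where
  "level E M a = (\<Sum>(m, g)\<in>#a. (expand E ^^ nat (M - m)) {#base_vertex g#})"

lemma level_empty [simp]: "level E M {#} = {#}"
  by (simp add: level_def)

lemma level_add [simp]: "level E M (a + b) = level E M a + level E M b"
  by (simp add: level_def)

lemma level_monom: "level E M (monom_gen m g) = (expand E ^^ nat (M - m)) {#base_vertex g#}"
  by (simp add: level_def monom_gen_def)

lemma level_sum: "level E M (sum h I) = (\<Sum>i\<in>I. level E M (h i))"
  by (induction I rule: infinite_finite_induct) auto

lemma level_shift: "level E M (shift n a) = level E (M - n) a"
  by (simp add: level_def shift_def multiset.map_comp o_def case_prod_unfold algebra_simps)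

lemma level_Suc:
  assumes "\<forall>(m, g)\<in>#a. m \<le> M"
  shows "level E (M + 1) a = expand E (level E M a)"
  using assms
proof (induction a rule: formal_sum_induct)
  case (add m g a)
  then have "m \<le> M" "\<forall>(m, g)\<in>#a. m \<le> M" by (simp_all add: monom_gen_def)
  \<comment> \<open>Here \<open>m\<close> must not exceed \<open>M\<close>: otherwise
    \<open>nat\<close> truncates and the left side need not be the successor of the right.\<close>
  moreover from this have "nat (M + 1 - m) = Suc (nat (M - m))" by simp
  ultimately show ?case using add.IH by (simp add: level_monom)
qed simp

lemma set_mset_level:
  "set_mset (level E M a) =
     (\<Union>(m, g)\<in>set_mset a. set_mset ((expand E ^^ nat (M - m)) {#base_vertex g#}))"
  by (auto simp: level_def)

lemma reach_expand: "u \<in># (expand E ^^ k) {#v#} \<Longrightarrow> reach E k v u"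
proof (induction k arbitrary: v)
  case (Suc k)
  have "(expand E ^^ Suc k) {#v#} = (\<Sum>e\<in>out_arcs E v. (expand E ^^ k) {#head E e#})"
    by (simp add: funpow_Suc_right expand_pow_sum del: funpow.simps)
  with Suc.prems have "u \<in># (\<Sum>e\<in>out_arcs E v. (expand E ^^ k) {#head E e#})" by simp
  \<comment> \<open>A sum over infinitely many edges would be empty and could not contain
    \<open>u\<close>.\<close>
  moreover from this have "finite (out_arcs E v)" by (metis empty_iff set_mset_empty sum.infinite)
  ultimately show ?case using Suc.IH by (auto simp: set_mset_sum)
qed simp

text \<open>For \<open>M\<close> above \<open>m\<close>, the first expansion of the monomial at
  \<open>v\<close> is exactly what (A1) does to it.\<close>

lemma level_A1:
  assumes "A1 E a b"
  shows "\<forall>\<^sub>F M in at_top. level E M a = level E M b"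
  using assms
proof cases
  case (1 c v m)
  have "level E M a = level E M b" if "M \<ge> m + 1" for M
  proof -
    have "nat (M - m) = Suc (nat (M - (m + 1)))" using that by simp
    then show ?thesis
      using 1(1,2) by (simp add: level_monom level_sum funpow_Suc_right expand_pow_sum del: funpow.simps)
  qed
  then show ?thesis by (auto simp: eventually_at_top_linorder)
qed

section \<open>High levels as an invariant of the congruence\<close>

lemma infinite_emitter_not_regular: "infinite_emitter E v \<Longrightarrow> \<not> regular_vertex E v"
  by (simp add: infinite_emitter_def regular_vertex_def)

text \<open>(A2) and (A3) act on a monomial whose trivial path already reaches an infinite
  emitter.\<close>

lemma regular_reach_step1:
  assumes "step1 E a b" "regular_reach E a"
  shows "A1 E a b"
proof -
  have not_regular_reach: "\<not> regular_reach E (c + monom_gen m g)"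
    if "infinite_emitter E v" "reach_gen E 0 g v" for c m g v
  proof -
    have "m + int 0 \<in> degs E v (monom_gen m g)" unfolding degs_monom using that(2) by blast
    then show ?thesis
      using infinite_emitter_not_regular[OF that(1)] unfolding regular_reach_def by auto
  qed
  have "\<not> A2 E a b" "\<not> A3 E a b"
    using assms(2) not_regular_reach by (auto elim!: A2.cases A3.cases)
  with assms(1) show ?thesis by (simp add: step1_def)
qed

lemma regular_reach_cong_gen: "cong_gen E a b \<Longrightarrow> regular_reach E a \<longleftrightarrow> regular_reach E b"
  unfolding regular_reach_def using degs_cong_gen by metis

lemma regular_reach_add [simp]:
  "regular_reach E (a + b) \<longleftrightarrow> regular_reach E a \<and> regular_reach E b"
  by (auto simp: regular_reach_def)

lemma regular_reach_shift [simp]: "regular_reach E (shift n a) \<longleftrightarrow> regular_reach E a"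
  by (simp add: regular_reach_def degs_shift)

text \<open>The property \<open>regular_reach\<close> passes along the congruence, so every single
  step is an (A1). The threshold for \<open>M\<close> depends on the derivation, hence the statement
  for all large \<open>M\<close>.\<close>

lemma level_cong_gen:
  assumes "cong_gen E a b" "regular_reach E a"
  shows "\<forall>\<^sub>F M in at_top. level E M a = level E M b"
  using assms
proof induction
  case (base a b)
  then have "(step1 E)\<^sup>*\<^sup>* a b" by (simp add: arrow_def)
  then have "regular_reach E b \<and> (\<forall>\<^sub>F M in at_top. level E M a = level E M b)"
  proof induction
    case base
    with \<open>regular_reach E a\<close> show ?case by simp
  next
    case (step b c)
    then have "A1 E b c" by (intro regular_reach_step1) auto
    then have "regular_reach E c" using step regular_reach_cong_gen A1_imp_cong_gen by blast
    moreover have "\<forall>\<^sub>F M in at_top. level E M a = level E M c"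
      using conjunct2[OF step.IH] level_A1[OF \<open>A1 E b c\<close>] by eventually_elim simp
    ultimately show ?case by blast
  qed
  then show ?case by blast
next
  case (refl a)
  show ?case by simp
next
  case (sym a b)
  then have "\<forall>\<^sub>F M in at_top. level E M a = level E M b" using regular_reach_cong_gen by blast
  then show ?case by eventually_elim simp
next
  case (trans a b c)
  then have "\<forall>\<^sub>F M in at_top. level E M a = level E M b" "\<forall>\<^sub>F M in at_top. level E M b = level E M c"
    using regular_reach_cong_gen by blast+
  then show ?case by eventually_elim simp
next
  case (add a b c d)
  then have "\<forall>\<^sub>F M in at_top. level E M a = level E M b" "\<forall>\<^sub>F M in at_top. level E M c = level E M d"
    by auto
  then show ?case by eventually_elim simp
next
  case (act a b n)
  then obtain N where "\<And>M. M \<ge> N \<Longrightarrow> level E M a = level E M b"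
    by (auto simp: eventually_at_top_linorder)
  then show ?case
    unfolding eventually_at_top_linorder by (intro exI[of _ "N + n"]) (simp add: level_shift)
qed

section \<open>Recurrent levels and tameness\<close>

context wf_digraph
begin

lemma size_expand_vertex: "size (\<Sum>e\<in>out_arcs G v. {#head G e#}) = card (out_arcs G v)"
  by (simp add: size_multiset_sum)

text \<open>A regular vertex is replaced by at least one vertex, and by exactly one only if it emits
  a single edge.\<close>

lemma size_expand:
  assumes "\<And>v. v \<in># V \<Longrightarrow> regular_vertex G v"
  shows "size V \<le> size (expand G V)"
    and "size (expand G V) = size V \<Longrightarrow> v \<in># V \<Longrightarrow> \<exists>e. out_arcs G v = {e}"
proof -
  have pos: "card (out_arcs G v) \<ge> 1" if "regular_vertex G v" for v
    using that by (simp add: regular_vertex_def Suc_le_eq card_gt_0_iff)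
  have "size V \<le> size (expand G V) \<and>
      (size (expand G V) = size V \<longrightarrow> (\<forall>v\<in>#V. card (out_arcs G v) = 1))"
    using assms
  proof (induction V)
    case (add v V)
    then have "card (out_arcs G v) \<ge> 1" by (intro pos) simp
    moreover have "size (expand G (add_mset v V)) = card (out_arcs G v) + size (expand G V)"
      by (simp add: expand_add_mset size_expand_vertex)
    ultimately show ?case using add by auto
  qed simp
  then show "size V \<le> size (expand G V)"
    and "size (expand G V) = size V \<Longrightarrow> v \<in># V \<Longrightarrow> \<exists>e. out_arcs G v = {e}"
    by (auto simp: card_1_singleton_iff)
qed

lemma expand_periodic_no_exit:
  assumes "n > 0" "(expand G ^^ n) V = V"
    and reg: "\<And>k v. v \<in># (expand G ^^ k) V \<Longrightarrow> regular_vertex G v"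
    and "v \<in># V"
  shows "v \<in> no_exit_verts G"
proof -
  let ?V = "\<lambda>k. (expand G ^^ k) V"
  have per: "?V (j * n) = V" for j
    by (induction j) (simp_all add: funpow_add assms(2))
  have mono: "size (?V k) \<le> size (?V (k + j))" for k j
  proof (induction j)
    case (Suc j)
    have "size (?V (k + j)) \<le> size (expand G (?V (k + j)))" by (rule size_expand(1)[OF reg])
    with Suc show ?case by simp
  qed simp
  \<comment> \<open>The sizes are nondecreasing, and \<open>V\<close> returns at step
    \<open>k * n\<close>, which is not before step \<open>k\<close>.\<close>
  have const: "size (?V k) = size V" for k
  proof (rule antisym)
    have "k \<le> k * n" using assms(1) by simp
    then show "size (?V k) \<le> size V" using mono[of k "k * n - k"] per[of k] by simp
    show "size V \<le> size (?V k)" using mono[of 0 k] by simp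
  qed
  have single: "\<exists>e. out_arcs G u = {e}" if "u \<in># ?V k" for u k
  proof (rule size_expand(2)[OF reg _ that])
    show "size (expand G (?V k)) = size (?V k)" using const[of "Suc k"] const[of k] by simp
  qed
  \<comment> \<open>Meaningful at the vertices of the multisets \<open>?V k\<close>, each of which
    emits exactly one edge.\<close>
  define f where "f u = (THE e. out_arcs G u = {e})" for u
  define s where "s u = head G (f u)" for u
  have f: "out_arcs G u = {f u}" if u: "u \<in># ?V k" for u k
  proof -
    obtain e where "out_arcs G u = {e}" using single[OF u] by blast
    then show ?thesis by (simp add: f_def)
  qed
  have expand_s: "expand G W = image_mset s W" if "\<And>u. u \<in># W \<Longrightarrow> out_arcs G u = {f u}" for W
    using that by (induction W) (simp_all add: expand_add_mset s_def)
  have pow_s: "?V k = image_mset (s ^^ k) V" for k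
  proof (induction k)
    case (Suc k)
    have "?V (Suc k) = image_mset s (?V k)" using expand_s[OF f] by simp
    then show ?case using Suc by (simp add: multiset.map_comp o_def)
  qed simp
  let ?S = "set_mset V"
  \<comment> \<open>A map of a finite set onto itself is injective, so \<open>s ^^ n\<close>
    permutes the vertices of \<open>V\<close>.\<close>
  have "(s ^^ n) ` ?S = ?S" using arg_cong[OF pow_s[of n], of set_mset] assms(2) by simp
  then have bij: "bij_betw (s ^^ n) ?S ?S"
    by (metis bij_betw_def eq_card_imp_inj_on finite_set_mset)
  \<comment> \<open>Extending by the identity outside \<open>?S\<close> gives an injection of the
    whole type, as \<open>funpow_inj_finite\<close> requires; on \<open>?S\<close> its powers are
    powers of \<open>s\<close>.\<close>
  define p where "p = (\<lambda>x. if x \<in> ?S then (s ^^ n) x else x)"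
  have "inj p"
    using bij by (auto simp: inj_def p_def bij_betw_def inj_on_def)
  have p_pow: "(p ^^ j) v = (s ^^ (j * n)) v \<and> (p ^^ j) v \<in> ?S" for j
  proof (induction j)
    case (Suc j)
    then have "(p ^^ Suc j) v = (s ^^ n) ((s ^^ (j * n)) v)" "(s ^^ (j * n)) v \<in> ?S"
      by (auto simp: p_def)
    then show ?case using bij by (auto simp: funpow_add bij_betw_def)
  qed (use assms(4) in simp)
  have "{y. \<exists>j. y = (p ^^ j) v} \<subseteq> ?S" using p_pow by blast
  then have "finite {y. \<exists>j. y = (p ^^ j) v}" by (rule finite_subset) simp
  then obtain j where j: "j > 0" "(p ^^ j) v = v"
    using funpow_inj_finite[OF \<open>inj p\<close>] by blast
  have "(s ^^ 0) v \<in> no_exit_verts G"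
  proof (rule cycle_no_exitI[where u = "\<lambda>i. (s ^^ i) v" and f = "\<lambda>i. f ((s ^^ i) v)" and j = "j * n"])
    show "out_arcs G ((s ^^ i) v) = {f ((s ^^ i) v)}" for i
      by (rule f[of _ i]) (use assms(4) in \<open>auto simp: pow_s\<close>)
  qed (use j assms(1) p_pow[of j] in \<open>auto simp: s_def\<close>)
  then show ?thesis by simp
qed

text \<open>Unfold the rule \<open>regular\<close> up to \<open>k\<close> times. The first
  assumption excludes sinks and infinite emitters, whose empty expansions would satisfy the second
  one vacuously.\<close>

lemma tame_if_expand_no_exit:
  assumes "\<And>j w. reach G j v w \<Longrightarrow> regular_vertex G w"
    and "\<And>w. w \<in># (expand G ^^ k) {#v#} \<Longrightarrow> w \<in> no_exit_verts G"
  shows "tame v"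
  using assms
proof (induction k arbitrary: v)
  case 0
  then show ?case by (intro tame.cycle) simp
next
  case (Suc k)
  have v: "regular_vertex G v" using Suc.prems(1)[of 0] by simp
  have "tame (head G e)" if e: "e \<in> out_arcs G v" for e
  proof (rule Suc.IH)
    show "regular_vertex G w" if "reach G j (head G e) w" for j w
      using Suc.prems(1)[of "Suc j"] e that by (metis reach.simps(2))
    have "(expand G ^^ Suc k) {#v#} = (\<Sum>e\<in>out_arcs G v. (expand G ^^ k) {#head G e#})"
      by (simp add: funpow_Suc_right expand_pow_sum del: funpow.simps)
    then have "set_mset ((expand G ^^ k) {#head G e#}) \<subseteq> set_mset ((expand G ^^ Suc k) {#v#})"
      using e v by (auto simp: set_mset_sum regular_vertex_def simp del: funpow.simps)
    then show "w \<in> no_exit_verts G" if "w \<in># (expand G ^^ k) {#head G e#}" for w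
      using Suc.prems(2) that by blast
  qed
  with v show ?case by (rule tame.regular)
qed

lemma periodic_tame:
  assumes "a \<in> free_monoid G" "periodic G a"
  shows "supp a \<subseteq> Proper ` Collect tame"
proof -
  have rr: "regular_reach G a" using assms(2) by (rule periodic_regular_reach)
  then have reach_regular: "regular_vertex G w" if "(m, g) \<in># a" "reach_gen G k g w" for m g k w
    using that unfolding regular_reach_def degs_def by blast
  have proper: "\<exists>v. g = Proper v" if mg: "(m, g) \<in># a" for m g
  proof (cases g)
    case (Improper v Z)
    have "g \<in> generators G" using assms(1) mg by (force simp: free_monoid_def supp_def)
    then have "infinite_emitter G v" using Improper by (auto simp: generators_def)
    moreover have "regular_vertex G v" using reach_regular[OF mg, of 0] Improper by simp
    ultimately show ?thesis by (simp add: infinite_emitter_not_regular)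
  qed simp
  obtain n where n: "n > 0" "cong_gen G a (shift n a)" using assms(2) by (auto simp: periodic_def)
  obtain N where N: "\<And>M. M \<ge> N \<Longrightarrow> level G M a = level G (M - n) a"
    using level_cong_gen[OF n(2) rr] by (auto simp: eventually_at_top_linorder level_shift)
  \<comment> \<open>Large enough for the levels to agree under translation by \<open>n\<close>, and
    at least every degree in \<open>a\<close>, so that \<open>level_Suc\<close> applies.\<close>
  define M where "M = Max (insert N (fst ` set_mset a))"
  have M: "N \<le> M" "\<And>m g. (m, g) \<in># a \<Longrightarrow> m \<le> M"
    unfolding M_def by (force intro: Max_ge)+
  let ?V = "level G M a"
  have level_pow: "(expand G ^^ k) ?V = level G (M + int k) a" for k
  proof (induction k)
    case (Suc k)
    have "\<forall>(m, g)\<in>#a. m \<le> M + int k" using M(2) by fastforce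
    then show ?case using Suc level_Suc[of a "M + int k" G] by (simp add: algebra_simps)
  qed simp
  have level_reach: "\<exists>m g k. (m, g) \<in># a \<and> reach_gen G k g w" if w: "w \<in># level G K a" for w K
  proof -
    obtain m g where mg: "(m, g) \<in># a" "w \<in># (expand G ^^ nat (K - m)) {#base_vertex g#}"
      using w by (auto simp: set_mset_level)
    moreover from this obtain v where "g = Proper v" using proper by blast
    ultimately have "reach_gen G (nat (K - m)) g w" by (simp add: reach_expand)
    with mg(1) show ?thesis by blast
  qed
  have no_exit: "w \<in> no_exit_verts G" if "w \<in># ?V" for w
  proof (rule expand_periodic_no_exit[OF _ _ _ that])
    show "0 < nat n" using n(1) by simp
    show "(expand G ^^ nat n) ?V = ?V" using N[of "M + n"] M(1) n(1) by (simp add: level_pow)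
    show "regular_vertex G u" if "u \<in># (expand G ^^ k) ?V" for k u
      using that level_reach reach_regular unfolding level_pow by blast
  qed
  show ?thesis
  proof
    fix g assume "g \<in> supp a"
    then obtain m where m: "(m, g) \<in># a" by (auto simp: supp_def)
    obtain v where v: "g = Proper v" using proper[OF m] by blast
    \<comment> \<open>The expansion of each monomial up to degree \<open>M\<close> is part of the
      level \<open>?V\<close>, whose vertices all lie on cycles without exits.\<close>
    have "set_mset ((expand G ^^ nat (M - m)) {#v#}) \<subseteq> set_mset ?V"
      using m v by (force simp: set_mset_level)
    then have "tame v"
      using no_exit reach_regular[OF m] v by (intro tame_if_expand_no_exit[of v "nat (M - m)"]) auto
    with v show "g \<in> Proper ` Collect tame" by simp
  qed
qed

end

theorem theorem5p1:
  fixes E :: "('v,'e) pre_digraph" and a :: "('v,'e) formal_sum"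
  assumes "wf_digraph E"
    and "a \<in> free_monoid E - {{#}}"
  defines "cond1 \<equiv> periodic E a"
    and "cond2 \<equiv> \<exists>b\<in>free_monoid E.
           supp b \<subseteq> Proper ` {v. \<exists>c. cycle_no_exit E c \<and> v \<in> cycle_verts E c} \<and> arrow_A1 E a b"
    and "cond3 \<equiv>
           (\<exists>C. finite C \<and> (\<forall>c\<in>C. cycle_no_exit E c) \<and>
             (\<forall>g\<in>supp a. \<forall>q. path_from E g q \<longrightarrow>
               (\<exists>p. path_prefix E q p \<and> (\<exists>c\<in>C. path_ends_in E p c) \<and>
                    (\<forall>v\<in>path_verts E p. regular_vertex E v)))) \<and>
           (\<forall>g\<in>supp a. \<forall>f. inf_path_from E g f \<longrightarrow>
             (\<exists>c. cycle_no_exit E c \<and> inf_path_ends_in f c))"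
  shows "(cond1 \<longleftrightarrow> cond2) \<and> (cond2 \<longleftrightarrow> cond3)"
proof -
  interpret wf_digraph E by fact
  have a: "a \<in> free_monoid E" using assms(2) by blast
  have 2: "cond2 \<longleftrightarrow> settles a"
    unfolding cond2_def settles_def no_exit_verts_def ..
  have 3: "cond3 \<longleftrightarrow> supp a \<subseteq> Proper ` Collect tame"
    unfolding cond3_def tame_iff_paths[OF a] extends_to_cycle_def ..
  have "cond1 \<longleftrightarrow> settles a"
    unfolding cond1_def using settles_periodic periodic_tame[OF a] settles_iff_tame by blast
  with 2 3 settles_iff_tame show ?thesis by blast
qed

end
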